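(* Let $H$ be the complement of the cycle on seven vertices, i.e. the graph with vertex set $\mathbb Z_7$ in which $u,v$ are adjacent exactly when their cyclic distance is two or three. Then $$\mathrm{lrw}(H)=2\qquad\text{and}\qquad \mathrm{anw}(H)=3,$$ and $H$ has no pair of false twins or true twins.
   Context: All graphs are finite, simple and undirected. Two distinct vertices $u,v$ of a graph are false twins if $N(u)=N(v)$, and true twins if $N[u]=N[v]$, where $N$ and $N[\cdot]$ denote open and closed neighborhoods. For a graph $G$, a layout is a linear order $\pi=(v_1,\dots,v_n)$ of $V(G)$; put $P_i=\{v_1,\dots,v_i\}$ for $0\le i\le n$. Linear rank-width: for $X\subseteq V(G)$ the cutrank $\rho_G(X)$ is the rank over $\mathbb F_2$ of the $X\times (V(G)\setminus X)$ adjacency matrix, and $\mathrm{lrw}(G)=\min_\pi\max_i\rho_G(P_i)$ over all layouts $\pi$. Active neighborhood-width: for $u\in P_i$ let $r_i^\pi(u)=N_G(u)\cap (V(G)\setminus P_i)$, let $\mathcal A_i^\pi=\{r_i^\pi(u):u\in P_i\}\setminus\{\emptyset\}$, and $\mathrm{anw}(G)=\min_\pi\max_i|\mathcal A_i^\pi|$ over all layouts $\pi$. *)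

theory Defs
  imports
    "HOL-Library.Z2"
    "HOL-Combinatorics.Multiset_Permutations"
    "Graph_Theory.Pair_Digraph"
    "Jordan_Normal_Form.DL_Rank"
begin

text \<open>
  A finite simple undirected graph is a \<^typ>\<open>'a pair_pre_digraph\<close> satisfying \<^const>\<open>pair_graph\<close>:
  finite, loop-free, and with a symmetric arc relation, so that an edge \<open>uv\<close> is represented by
  the two arcs \<open>(u, v)\<close> and \<open>(v, u)\<close>.
\<close>

definition open_nbhd :: "'a pair_pre_digraph \<Rightarrow> 'a \<Rightarrow> 'a set" where
  "open_nbhd G u = {v \<in> pverts G. (u, v) \<in> parcs G}"

definition closed_nbhd :: "'a pair_pre_digraph \<Rightarrow> 'a \<Rightarrow> 'a set" where
  "closed_nbhd G u = insert u (open_nbhd G u)"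

definition false_twins :: "'a pair_pre_digraph \<Rightarrow> 'a \<Rightarrow> 'a \<Rightarrow> bool" where
  "false_twins G u v \<longleftrightarrow>
     u \<in> pverts G \<and> v \<in> pverts G \<and> u \<noteq> v \<and> open_nbhd G u = open_nbhd G v"

definition true_twins :: "'a pair_pre_digraph \<Rightarrow> 'a \<Rightarrow> 'a \<Rightarrow> bool" where
  "true_twins G u v \<longleftrightarrow>
     u \<in> pverts G \<and> v \<in> pverts G \<and> u \<noteq> v \<and> closed_nbhd G u = closed_nbhd G v"

text \<open>
  A layout is a list that enumerates the vertex set without repetition.  The prefix
  \<open>P\<^sub>i\<close> of a layout \<open>p\<close> is \<open>set (take i p)\<close>, for \<open>0 \<le> i \<le> n\<close>.
\<close>

definition layouts :: "'a pair_pre_digraph \<Rightarrow> 'a list set" where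
  "layouts G = permutations_of_set (pverts G)"

text \<open>
  Matrices of the library are indexed by initial segments of the naturals.  Rows and columns
  of the \<open>X \<times> Y\<close> adjacency matrix are therefore listed in increasing order of the vertices;
  the rank does not depend on this choice of enumeration.
\<close>

definition adj_matrix :: "'a::linorder pair_pre_digraph \<Rightarrow> 'a set \<Rightarrow> 'a set \<Rightarrow> bit mat" where
  "adj_matrix G X Y = mat (card X) (card Y)
     (\<lambda>(i, j). if (sorted_list_of_set X ! i, sorted_list_of_set Y ! j) \<in> parcs G then 1 else 0)"

text \<open>The first argument of \<^const>\<open>vec_space.rank\<close> is the number of rows.\<close>

definition cutrank :: "'a::linorder pair_pre_digraph \<Rightarrow> 'a set \<Rightarrow> nat" where
  "cutrank G X = vec_space.rank (card X) (adj_matrix G X (pverts G - X))"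

definition lrw :: "'a::linorder pair_pre_digraph \<Rightarrow> nat" where
  "lrw G = (MIN p \<in> layouts G. MAX i \<in> {0..card (pverts G)}. cutrank G (set (take i p)))"

definition active_nbhds :: "'a pair_pre_digraph \<Rightarrow> 'a set \<Rightarrow> 'a set set" where
  "active_nbhds G X = (\<lambda>u. open_nbhd G u \<inter> (pverts G - X)) ` X - {{}}"

definition anw :: "'a pair_pre_digraph \<Rightarrow> nat" where
  "anw G = (MIN p \<in> layouts G. MAX i \<in> {0..card (pverts G)}. card (active_nbhds G (set (take i p))))"

definition graph_complement :: "'a pair_pre_digraph \<Rightarrow> 'a pair_pre_digraph" where
  "graph_complement G = \<lparr> pverts = pverts G,
     parcs = {(u, v). u \<in> pverts G \<and> v \<in> pverts G \<and> u \<noteq> v \<and> (u, v) \<notin> parcs G} \<rparr>"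

text \<open>The integers modulo \<open>n\<close> are represented by their least non-negative residues.\<close>

definition cycle_graph :: "nat \<Rightarrow> int pair_pre_digraph" where
  "cycle_graph n = \<lparr> pverts = {0..<int n},
     parcs = {(u, v). u \<in> {0..<int n} \<and> v \<in> {0..<int n} \<and>
                      (v = (u + 1) mod int n \<or> u = (v + 1) mod int n)} \<rparr>"

definition co_C7 :: "int pair_pre_digraph" where
  "co_C7 = graph_complement (cycle_graph 7)"

definition cyclic_dist :: "nat \<Rightarrow> int \<Rightarrow> int \<Rightarrow> int" where
  "cyclic_dist n u v = min ((u - v) mod int n) ((v - u) mod int n)"

lemma pverts_co_C7: "pverts co_C7 = {0..<7}"
  by (simp add: co_C7_def graph_complement_def cycle_graph_def)

lemma parcs_co_C7_iff:
  "(u, v) \<in> parcs co_C7 \<longleftrightarrow>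
     u \<in> {0..<7} \<and> v \<in> {0..<7} \<and> cyclic_dist 7 u v \<in> {2, 3}"
proof (cases "u \<in> {0..<7} \<and> v \<in> {0..<7}")
  case True
  have "{0..<7::int} = {0, 1, 2, 3, 4, 5, 6}" by auto
  with True have "u \<in> {0, 1, 2, 3, 4, 5, 6}" "v \<in> {0, 1, 2, 3, 4, 5, 6}" by simp_all
  then show ?thesis
    by (elim insertE emptyE)
      (simp_all add: co_C7_def graph_complement_def cycle_graph_def cyclic_dist_def)
next
  case False
  then show ?thesis
    by (auto simp: co_C7_def graph_complement_def cycle_graph_def)
qed

lemma pair_graph_co_C7: "pair_graph co_C7"
proof
  have sub: "parcs co_C7 \<subseteq> {0..<7} \<times> {0..<7}"
    by (auto simp: parcs_co_C7_iff)
  show "finite (pverts co_C7)" by (simp add: pverts_co_C7)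
  show "finite (parcs co_C7)" by (rule finite_subset[OF sub]) simp
  show "fst e \<in> pverts co_C7" if "e \<in> parcs co_C7" for e
    using that sub by (auto simp: pverts_co_C7)
  show "snd e \<in> pverts co_C7" if "e \<in> parcs co_C7" for e
    using that sub by (auto simp: pverts_co_C7)
  show "fst e \<noteq> snd e" if "e \<in> parcs co_C7" for e
    using that by (cases e) (auto simp: co_C7_def graph_complement_def)
  have "sym (parcs co_C7)"
    by (auto simp: sym_def parcs_co_C7_iff cyclic_dist_def min.commute)
  then show "symmetric co_C7" by (simp add: symmetric_def)
qed

end

theory Submission
  imports Defs
begin

text \<open>
  For distinct \<open>u\<close> and \<open>v\<close>, each has a neighbour that is neither equal nor adjacent to the other.
  This rules out twins and gives cutrank 2 to every pair.  For a set of three vertices, at least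
  one of the two private neighbours lies outside the set; since every degree is 4, the three
  outer neighbourhoods are therefore distinct and nonempty.  So every layout has a prefix of
  size 2 with cutrank at least 2 and a prefix of size 3 with three active neighbourhoods.
  Both upper bounds come from the layout \<open>0, 1, 4, 3, 2, 5, 6\<close>.
\<close>

section \<open>Layout widths, matrix rank and cutrank\<close>

text \<open>One layout bounds the minimum from above. For the lower bound, every layout passes
  through a prefix of size \<open>j\<close>, so it suffices that all vertex sets of that size have
  value at least \<open>k\<close>.\<close>

lemma layout_width_eqI:
  fixes f :: "'a set \<Rightarrow> 'b::linorder"
  assumes p: "p \<in> layouts G"
    and upper: "\<And>i. i \<le> card (pverts G) \<Longrightarrow> f (set (take i p)) \<le> k"
    and j: "j \<le> card (pverts G)"
    and lower: "\<And>X. X \<subseteq> pverts G \<Longrightarrow> card X = j \<Longrightarrow> k \<le> f X"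
  shows "(MIN p \<in> layouts G. MAX i \<in> {0..card (pverts G)}. f (set (take i p))) = k"
proof (rule antisym)
  have fin: "finite (layouts G)"
    by (simp add: layouts_def)
  have "(MIN p \<in> layouts G. MAX i \<in> {0..card (pverts G)}. f (set (take i p)))
      \<le> (MAX i \<in> {0..card (pverts G)}. f (set (take i p)))"
    using fin p by (intro Min_le) auto
  also have "\<dots> \<le> k"
    using upper by (intro Max.boundedI) auto
  finally show "(MIN p \<in> layouts G. MAX i \<in> {0..card (pverts G)}. f (set (take i p))) \<le> k" .
  have "k \<le> (MAX i \<in> {0..card (pverts G)}. f (set (take i q)))" if "q \<in> layouts G" for q
  proof -
    from that have q: "set q = pverts G" "distinct q"
      by (auto simp: layouts_def permutations_of_set_def)
    have "card (set (take j q)) = j"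
      using q j distinct_card[of q] by (simp add: distinct_card)
    then have "k \<le> f (set (take j q))"
      using q(1) set_take_subset[of j q] by (intro lower) auto
    also have "\<dots> \<le> (MAX i \<in> {0..card (pverts G)}. f (set (take i q)))"
      using j by (intro Max_ge) auto
    finally show ?thesis .
  qed
  then show "k \<le> (MIN p \<in> layouts G. MAX i \<in> {0..card (pverts G)}. f (set (take i p)))"
    using fin p by (intro Min.boundedI) auto
qed

text \<open>Each of the two summands is an outer product, of rank at most 1, and rank is
  subadditive.\<close>

lemma (in vec_space) rank_le_2_product_entries:
  assumes A: "A \<in> carrier_mat n nc"
    and entries: "\<And>r c. r < n \<Longrightarrow> c < nc \<Longrightarrow> A $$ (r, c) = f r * g c + f' r * g' c"
  shows "rank A \<le> 2"
proof -
  let ?B = "mat n nc (\<lambda>(r, c). f r * g c)" and ?B' = "mat n nc (\<lambda>(r, c). f' r * g' c)"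
  have "A = ?B + ?B'"
    using A by (intro eq_matI) (auto simp: entries)
  moreover have "rank (?B + ?B') \<le> rank ?B + rank ?B'"
    by (rule rank_subadditive[of _ nc]) auto
  moreover have "rank ?B \<le> 1"
    by (rule rank_le_1_product_entries[of _ nc f g]) auto
  moreover have "rank ?B' \<le> 1"
    by (rule rank_le_1_product_entries[of _ nc f' g']) auto
  ultimately show ?thesis by simp
qed

text \<open>On the coordinates \<open>i\<close> and \<open>j\<close> the two vectors are the unit
  vectors, so these coordinates of a vanishing combination are its coefficients.\<close>

lemma lin_indpt_pair_bit:
  fixes u v :: "bit vec"
  assumes carrier: "u \<in> carrier_vec n" "v \<in> carrier_vec n"
    and i: "i < n" "u $ i = 1" "v $ i = 0"
    and j: "j < n" "u $ j = 0" "v $ j = 1"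
  shows "module.lin_indpt class_ring (module_vec TYPE(bit) n) {u, v}"
proof -
  interpret vec_space "TYPE(bit)" n .
  have "u \<noteq> v" using i by auto
  show ?thesis
  proof
    assume "lin_dep {u, v}"
    then obtain a w where a: "lincomb a {u, v} = 0\<^sub>v n" and w: "w \<in> {u, v}" "a w \<noteq> 0"
      using finite_lin_dep[of "{u, v}"] carrier by auto
    have eq: "a u * u $ l + a v * v $ l = 0" if "l < n" for l
    proof -
      have "a u * u $ l + a v * v $ l = (\<Sum>x\<in>{u, v}. a x * x $ l)"
        using \<open>u \<noteq> v\<close> by (subst sum.insert) auto
      also have "\<dots> = lincomb a {u, v} $ l"
        using lincomb_index[OF that, of "{u, v}" a] carrier by simp
      finally show ?thesis using a that by simp
    qed
    show False
      using eq[OF i(1)] eq[OF j(1)] i j w by auto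
  qed
qed

text \<open>This moves the rank bound from matrix indices to vertices, so that later arguments can
  ignore the sorted enumerations.\<close>

lemma cutrank_le_2I:
  fixes G :: "'a::linorder pair_pre_digraph"
  assumes fin: "finite (pverts G)" "X \<subseteq> pverts G"
    and entries: "\<And>u v. u \<in> X \<Longrightarrow> v \<in> pverts G - X \<Longrightarrow>
      (if (u, v) \<in> parcs G then 1 else 0 :: bit) = f u * g v + f' u * g' v"
  shows "cutrank G X \<le> 2"
proof -
  let ?x = "\<lambda>i. sorted_list_of_set X ! i" and ?y = "\<lambda>j. sorted_list_of_set (pverts G - X) ! j"
  have finX: "finite X" using fin by (rule finite_subset[rotated])
  have mem: "?x i \<in> X" if "i < card X" for i
    using that finX nth_mem[of i "sorted_list_of_set X"] by simp
  have mem': "?y j \<in> pverts G - X" if "j < card (pverts G - X)" for j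
    using that fin nth_mem[of j "sorted_list_of_set (pverts G - X)"] by simp
  show ?thesis
    unfolding cutrank_def
  proof (rule vec_space.rank_le_2_product_entries)
    show "adj_matrix G X (pverts G - X) \<in> carrier_mat (card X) (card (pverts G - X))"
      by (simp add: adj_matrix_def)
  next
    fix r c assume "r < card X" "c < card (pverts G - X)"
    then show "adj_matrix G X (pverts G - X) $$ (r, c) =
        f (?x r) * g (?y c) + f' (?x r) * g' (?y c)"
      using entries[OF mem mem'] by (simp add: adj_matrix_def)
  qed
qed

lemma cutrank_le_card_compl: "cutrank G X \<le> card (pverts G - X)"
  unfolding cutrank_def by (rule vec_space.rank_le_nc) (simp add: adj_matrix_def)

lemma ex_index_sorted_list_of_set:
  assumes "finite X" "x \<in> X"
  shows "\<exists>i<card X. sorted_list_of_set X ! i = x"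
  using assms by (metis in_set_conv_nth length_sorted_list_of_set set_sorted_list_of_set)

text \<open>In the two-row matrix of the cut, the columns of \<open>w\<close> and \<open>w'\<close>
  are the two unit vectors, hence independent.\<close>

lemma cutrank_pair_ge_2:
  fixes G :: "'a::linorder pair_pre_digraph"
  assumes fin: "finite (pverts G)" "u \<noteq> v"
    and w: "w \<in> pverts G - {u, v}" "(u, w) \<in> parcs G" "(v, w) \<notin> parcs G"
    and w': "w' \<in> pverts G - {u, v}" "(v, w') \<in> parcs G" "(u, w') \<notin> parcs G"
  shows "2 \<le> cutrank G {u, v}"
proof -
  define Y where "Y = pverts G - {u, v}"
  define A where "A = adj_matrix G {u, v} Y"
  have card: "card {u, v} = 2" using fin by simp
  have A: "A \<in> carrier_mat 2 (card Y)"
    unfolding A_def adj_matrix_def by (simp only: card mat_carrier)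
  have finY: "finite Y" using fin by (simp add: Y_def)
  obtain i where i: "i < 2" "sorted_list_of_set {u, v} ! i = u"
    using ex_index_sorted_list_of_set[of "{u, v}" u] card by auto
  obtain j where j: "j < 2" "sorted_list_of_set {u, v} ! j = v"
    using ex_index_sorted_list_of_set[of "{u, v}" v] card by auto
  obtain k where k: "k < card Y" "sorted_list_of_set Y ! k = w"
    using ex_index_sorted_list_of_set[OF finY] w by (auto simp: Y_def)
  obtain l where l: "l < card Y" "sorted_list_of_set Y ! l = w'"
    using ex_index_sorted_list_of_set[OF finY] w' by (auto simp: Y_def)
  have entry: "A $$ (r, c) = (if (sorted_list_of_set {u, v} ! r, sorted_list_of_set Y ! c)
      \<in> parcs G then 1 else 0)" if "r < 2" "c < card Y" for r c
    unfolding A_def adj_matrix_def using that by (simp only: card index_mat prod.case)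
  have cols: "col A k $ i = 1" "col A k $ j = 0" "col A l $ i = 0" "col A l $ j = 1"
    using A i j k l w w' by (simp_all add: entry)
  have "{col A k, col A l} \<subseteq> set (cols A)"
    using A k l by (auto simp: cols_def)
  moreover have "module.lin_indpt class_ring (module_vec TYPE(bit) 2) {col A k, col A l}"
    using col_carrier_vec[OF k(1) A] col_carrier_vec[OF l(1) A] i(1) cols(1,3) j(1) cols(2,4)
    by (rule lin_indpt_pair_bit)
  ultimately have "card {col A k, col A l} \<le> vec_space.rank 2 A"
    by (intro vec_space.rank_ge_card_indpt[OF A])
  moreover have "col A k \<noteq> col A l"
    using cols by auto
  ultimately show ?thesis
    unfolding cutrank_def card A_def Y_def by simp
qed

section \<open>Neighbourhoods in the complement of the 7-cycle\<close>

lemma residues_7: "{0..<7::int} = {0, 1, 2, 3, 4, 5, 6}"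
  by auto

text \<open>The candidates for \<open>w\<close> are the non-neighbours v-1 and v+1 of
  \<open>v\<close>. Both fail only if both lie in {u-1, u, u+1} modulo 7, which forces u = v. The
  proof evaluates all pairs.\<close>

lemma co_C7_private_neighbour:
  assumes "u \<in> pverts co_C7" "v \<in> pverts co_C7" "u \<noteq> v"
  obtains w where "w \<in> pverts co_C7 - {u, v}" "(u, w) \<in> parcs co_C7" "(v, w) \<notin> parcs co_C7"
proof -
  have "\<forall>u\<in>{0..<7}. \<forall>v\<in>{0..<7}. u \<noteq> v \<longrightarrow>
      (\<exists>w\<in>{0..<7}. w \<noteq> u \<and> w \<noteq> v \<and> (u, w) \<in> parcs co_C7 \<and> (v, w) \<notin> parcs co_C7)"
    unfolding residues_7 by (simp add: parcs_co_C7_iff cyclic_dist_def)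
  then show ?thesis
    using assms that unfolding pverts_co_C7 by blast
qed

lemma open_nbhd_co_C7:
  "open_nbhd co_C7 0 = {2, 3, 4, 5}" "open_nbhd co_C7 1 = {3, 4, 5, 6}"
  "open_nbhd co_C7 2 = {4, 5, 6, 0}" "open_nbhd co_C7 3 = {5, 6, 0, 1}"
  "open_nbhd co_C7 4 = {6, 0, 1, 2}" "open_nbhd co_C7 5 = {0, 1, 2, 3}"
  "open_nbhd co_C7 6 = {1, 2, 3, 4}"
proof -
  have eq: "open_nbhd co_C7 u = Set.filter (\<lambda>v. cyclic_dist 7 u v \<in> {2, 3}) {0, 1, 2, 3, 4, 5, 6}"
    if "u \<in> {0..<7}" for u
    using that unfolding open_nbhd_def pverts_co_C7 residues_7[symmetric]
    by (auto simp: parcs_co_C7_iff)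
  show "open_nbhd co_C7 0 = {2, 3, 4, 5}" "open_nbhd co_C7 1 = {3, 4, 5, 6}"
    "open_nbhd co_C7 2 = {4, 5, 6, 0}" "open_nbhd co_C7 3 = {5, 6, 0, 1}"
    "open_nbhd co_C7 4 = {6, 0, 1, 2}" "open_nbhd co_C7 5 = {0, 1, 2, 3}"
    "open_nbhd co_C7 6 = {1, 2, 3, 4}"
    by (subst eq; auto simp: cyclic_dist_def)+
qed

lemma card_open_nbhd_co_C7: "u \<in> pverts co_C7 \<Longrightarrow> card (open_nbhd co_C7 u) = 4"
  unfolding pverts_co_C7 residues_7 by (auto simp: open_nbhd_co_C7)

text \<open>A private neighbour differs from both vertices, so it separates their closed
  neighbourhoods as well as their open ones.\<close>

lemma co_C7_no_twins: "\<not> false_twins co_C7 u v" "\<not> true_twins co_C7 u v"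
proof -
  have "\<exists>w. w \<noteq> u \<and> w \<noteq> v \<and> w \<in> open_nbhd co_C7 u \<and> w \<notin> open_nbhd co_C7 v"
    if "u \<in> pverts co_C7" "v \<in> pverts co_C7" "u \<noteq> v"
    using co_C7_private_neighbour[OF that] by (auto simp: open_nbhd_def)
  then show "\<not> false_twins co_C7 u v" "\<not> true_twins co_C7 u v"
    by (auto simp: false_twins_def true_twins_def closed_nbhd_def)
qed

lemma card_active_nbhds_triple:
  assumes X: "X \<subseteq> pverts co_C7" "card X = 3"
  shows "card (active_nbhds co_C7 X) = 3"
proof -
  let ?r = "\<lambda>u. open_nbhd co_C7 u \<inter> (pverts co_C7 - X)"
  have third: "\<exists>z. X = {u, v, z}" if "u \<in> X" "v \<in> X" "u \<noteq> v" for u v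
  proof -
    have "card (X - {u, v}) = 1"
      using that X(2) by (subst card_Diff_subset) auto
    then obtain z where "X - {u, v} = {z}" by (auto simp: card_1_singleton_iff)
    then show ?thesis using that by (intro exI[of _ z]) auto
  qed
  have "inj_on ?r X"
  proof (rule inj_onI, rule ccontr)
    fix u v assume uv: "u \<in> X" "v \<in> X" "u \<noteq> v" and eq: "?r u = ?r v"
    obtain z where z: "X = {u, v, z}" using third[OF uv] by (rule exE)
    obtain w where w: "w \<in> pverts co_C7 - {u, v}" "(u, w) \<in> parcs co_C7" "(v, w) \<notin> parcs co_C7"
      using co_C7_private_neighbour uv X by blast
    obtain w' where w': "w' \<in> pverts co_C7 - {v, u}" "(v, w') \<in> parcs co_C7" "(u, w') \<notin> parcs co_C7"
      using co_C7_private_neighbour uv X by blast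
    \<comment> \<open>the two private neighbours differ, so at most one of them is \<open>z\<close>\<close>
    have "w \<noteq> z \<or> w' \<noteq> z" using w w' by auto
    \<comment> \<open>A private neighbour other than \<open>z\<close> lies outside \<open>X\<close>,
      hence in exactly one of \<open>?r u\<close> and \<open>?r v\<close>.\<close>
    then show False
      using eq w w' unfolding z open_nbhd_def by blast
  qed
  \<comment> \<open>Inside \<open>X\<close> there are at most two neighbours of \<open>u\<close>,
    but \<open>u\<close> has four.\<close>
  moreover have "?r u \<noteq> {}" if u: "u \<in> X" for u
  proof -
    obtain v where v: "v \<in> X" "u \<noteq> v"
    proof -
      have "X \<noteq> {u}" using X(2) by auto
      with u that show ?thesis by auto
    qed
    obtain z where z: "X = {u, v, z}" using third[OF u v] by (rule exE)
    have "card {v, z} \<le> 2" by (cases "v = z") auto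
    moreover have "card (open_nbhd co_C7 u) = 4"
      using u X(1) by (intro card_open_nbhd_co_C7) auto
    ultimately have "\<not> open_nbhd co_C7 u \<subseteq> {v, z}"
      using card_mono[of "{v, z}" "open_nbhd co_C7 u"] by auto
    moreover have "u \<notin> open_nbhd co_C7 u"
      by (simp add: open_nbhd_def parcs_co_C7_iff cyclic_dist_def)
    ultimately show ?thesis unfolding z open_nbhd_def by blast
  qed
  ultimately have "active_nbhds co_C7 X = ?r ` X" "card (?r ` X) = 3"
    using X(2) by (auto simp: active_nbhds_def card_image)
  then show ?thesis by simp
qed

section \<open>Cutrank along the chosen layout\<close>

lemma layout_co_C7: "[0, 1, 4, 3, 2, 5, 6] \<in> layouts co_C7"
  by (auto simp: layouts_def permutations_of_set_def pverts_co_C7)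

text \<open>The split reflects two sources of bounds: the first group has at most four vertices and
  is handled through relations between rows, while the second leaves at most two vertices
  outside.\<close>

lemma co_C7_prefix_cases:
  assumes "i \<le> card (pverts co_C7)"
    and "X = set (take i [0, 1, 4, 3, 2, 5, 6 :: int])"
  shows "X \<in> {{}, {0}, {0, 1}, {0, 1, 4}, {0, 1, 4, 3}} \<or>
    X \<in> {{0, 1, 4, 3, 2}, {0, 1, 4, 3, 2, 5}, {0, 1, 4, 3, 2, 5, 6}}"
proof -
  have "i \<in> {0, 1, 2, 3, 4, 5, 6, 7}"
    using assms(1) by (auto simp: pverts_co_C7)
  then show ?thesis
    unfolding assms(2) by (elim insertE emptyE) simp_all
qed

lemma cutrank_co_C7_small:
  assumes X: "X \<in> {{}, {0}, {0, 1}, {0, 1, 4}, {0, 1, 4, 3}}"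
  shows "cutrank co_C7 X \<le> 2"
proof -
  let ?E = "\<lambda>u v. (u, v) \<in> parcs co_C7"
  let ?adj = "\<lambda>u v. if ?E u v then 1 else 0 :: bit"
  \<comment> \<open>across the cut, the row of 3 agrees with that of 1, and the row of 4 is the sum of those of 0 and 1\<close>
  have rows: "?E 3 v \<longleftrightarrow> ?E 1 v" if "v \<in> {2, 5, 6}" for v
    using that by (elim insertE emptyE) (simp_all add: parcs_co_C7_iff cyclic_dist_def)
  have rows': "?E 4 v \<longleftrightarrow> ?E 0 v \<noteq> ?E 1 v" if "v \<in> {2, 3, 5, 6}" for v
    using that by (elim insertE emptyE) (simp_all add: parcs_co_C7_iff cyclic_dist_def)
  \<comment> \<open>The indicators are the coefficients of the rows of 0 and 1; 4 occurs in both
    because its row is their sum.\<close>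
  have entries: "?adj u v = of_bool (u \<in> {0, 4}) * ?adj 0 v + of_bool (u \<in> {1, 3, 4}) * ?adj 1 v"
    if uv: "u \<in> X" "v \<in> pverts co_C7 - X" for u v
  proof -
    \<comment> \<open>The sets form a chain: once 4 is in \<open>X\<close>, so are 0 and 1, and once
      3 is in \<open>X\<close>, so are 0, 1 and 4. This confines \<open>v\<close> to the columns
      where \<open>rows'\<close> and \<open>rows\<close> apply.\<close>
    have "u \<in> {0, 1} \<or> u = 4 \<and> v \<in> {2, 3, 5, 6} \<or> u = 3 \<and> v \<in> {2, 5, 6}"
      using uv X unfolding pverts_co_C7 residues_7 by auto
    then consider "u = 0" | "u = 1" | "u = 4" "v \<in> {2, 3, 5, 6}" | "u = 3" "v \<in> {2, 5, 6}"
      by blast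
    then show ?thesis
    proof cases
      case 3
      show ?thesis using rows'[OF 3(2)] unfolding 3(1) by (cases "?E 0 v"; cases "?E 1 v") simp_all
    next
      case 4
      show ?thesis using rows[OF 4(2)] unfolding 4(1) by simp
    qed simp_all
  qed
  show ?thesis
  proof (rule cutrank_le_2I[OF _ _ entries])
    show "finite (pverts co_C7)" "X \<subseteq> pverts co_C7"
      using X unfolding pverts_co_C7 by auto
  qed
qed

lemma card_compl_co_C7_large:
  assumes "X \<in> {{0, 1, 4, 3, 2}, {0, 1, 4, 3, 2, 5}, {0, 1, 4, 3, 2, 5, 6}}"
  shows "card (pverts co_C7 - X) \<le> 2"
  using assms unfolding pverts_co_C7 residues_7 by (auto simp: insert_Diff_if)

lemma cutrank_co_C7_large:
  assumes "X \<in> {{0, 1, 4, 3, 2}, {0, 1, 4, 3, 2, 5}, {0, 1, 4, 3, 2, 5, 6}}"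
  shows "cutrank co_C7 X \<le> 2"
  using cutrank_le_card_compl card_compl_co_C7_large[OF assms] by (rule order_trans)

lemma cutrank_co_C7_prefix:
  assumes "i \<le> card (pverts co_C7)"
  shows "cutrank co_C7 (set (take i [0, 1, 4, 3, 2, 5, 6])) \<le> 2"
  using co_C7_prefix_cases[OF assms refl] cutrank_co_C7_small cutrank_co_C7_large by (rule disjE)

section \<open>Active neighbourhoods along the chosen layout\<close>

lemma card_active_nbhds_le_card: "finite X \<Longrightarrow> card (active_nbhds G X) \<le> card X"
  unfolding active_nbhds_def by (meson Diff_subset card_image_le card_mono finite_imageI order_trans)

text \<open>Active neighbourhoods are nonempty subsets of the outside, so two outside vertices allow
  at most three of them.\<close>

lemma card_active_nbhds_le_compl:
  assumes "finite (pverts G)"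
  shows "card (active_nbhds G X) \<le> 2 ^ card (pverts G - X) - 1"
proof -
  have "active_nbhds G X \<subseteq> Pow (pverts G - X) - {{}}"
    by (auto simp: active_nbhds_def)
  then have "card (active_nbhds G X) \<le> card (Pow (pverts G - X) - {{}})"
    using assms by (intro card_mono) auto
  also have "\<dots> = 2 ^ card (pverts G - X) - 1"
    using assms by (subst card_Diff_subset) (auto simp: card_Pow)
  finally show ?thesis .
qed

text \<open>Only the prefix with four vertices exceeds the trivial bound by size; there 1 and 3 have
  the same outer neighbourhood {5, 6}.\<close>

lemma card_active_nbhds_co_C7_small:
  assumes "X \<in> {{}, {0}, {0, 1}, {0, 1, 4}, {0, 1, 4, 3}}"
  shows "card (active_nbhds co_C7 X) \<le> 3"
proof (cases "X = {0, 1, 4, 3}")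
  case True
  let ?r = "\<lambda>u. open_nbhd co_C7 u \<inter> (pverts co_C7 - X)"
  have "?r 3 = ?r 1"
    unfolding True open_nbhd_co_C7 by auto
  then have "active_nbhds co_C7 X \<subseteq> ?r ` {0, 1, 4}"
    unfolding active_nbhds_def using True by auto
  then have "card (active_nbhds co_C7 X) \<le> card (?r ` {0, 1, 4})"
    by (intro card_mono) auto
  also have "\<dots> \<le> card {0, 1, 4 :: int}"
    by (rule card_image_le) simp
  finally show ?thesis by simp
next
  case False
  then have "finite X" "card X \<le> 3"
    using assms by auto
  then show ?thesis
    using card_active_nbhds_le_card order_trans by blast
qed

lemma card_active_nbhds_co_C7_large:
  assumes "X \<in> {{0, 1, 4, 3, 2}, {0, 1, 4, 3, 2, 5}, {0, 1, 4, 3, 2, 5, 6}}"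
  shows "card (active_nbhds co_C7 X) \<le> 3"
proof -
  have "card (active_nbhds co_C7 X) \<le> 2 ^ card (pverts co_C7 - X) - 1"
    by (rule card_active_nbhds_le_compl) (simp add: pverts_co_C7)
  also have "\<dots> \<le> 2 ^ 2 - 1"
    using card_compl_co_C7_large[OF assms] by (intro diff_le_mono power_increasing) auto
  finally show ?thesis by simp
qed

lemma card_active_nbhds_co_C7_prefix:
  assumes "i \<le> card (pverts co_C7)"
  shows "card (active_nbhds co_C7 (set (take i [0, 1, 4, 3, 2, 5, 6]))) \<le> 3"
  using co_C7_prefix_cases[OF assms refl] card_active_nbhds_co_C7_small
    card_active_nbhds_co_C7_large by (rule disjE)

theorem lemma5p6:
  shows "lrw co_C7 = 2 \<and> anw co_C7 = 3 \<and>
    \<not> (\<exists>u v. false_twins co_C7 u v \<or> true_twins co_C7 u v)"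
proof (intro conjI)
  show "lrw co_C7 = 2"
    unfolding lrw_def
  proof (rule layout_width_eqI[where f = "cutrank co_C7", OF layout_co_C7 cutrank_co_C7_prefix])
    show "2 \<le> card (pverts co_C7)" by (simp add: pverts_co_C7)
  next
    fix X assume X: "X \<subseteq> pverts co_C7" "card X = 2"
    then obtain u v where uv: "X = {u, v}" "u \<noteq> v" by (auto simp: card_2_iff)
    obtain w where w: "w \<in> pverts co_C7 - {u, v}" "(u, w) \<in> parcs co_C7" "(v, w) \<notin> parcs co_C7"
      using co_C7_private_neighbour uv X by blast
    \<comment> \<open>The private neighbour is not symmetric in \<open>u\<close> and
      \<open>v\<close>, so a second one is taken with the roles exchanged.\<close>
    obtain w' where w': "w' \<in> pverts co_C7 - {u, v}" "(v, w') \<in> parcs co_C7" "(u, w') \<notin> parcs co_C7"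
      using co_C7_private_neighbour uv X by (metis insert_commute insert_subset)
    show "2 \<le> cutrank co_C7 X"
      unfolding uv(1) by (rule cutrank_pair_ge_2[OF _ uv(2) w w']) (simp add: pverts_co_C7)
  qed
  show "anw co_C7 = 3"
    unfolding anw_def
  proof (rule layout_width_eqI[where f = "\<lambda>X. card (active_nbhds co_C7 X)",
        OF layout_co_C7 card_active_nbhds_co_C7_prefix])
    show "3 \<le> card (pverts co_C7)" by (simp add: pverts_co_C7)
  next
    show "3 \<le> card (active_nbhds co_C7 X)" if "X \<subseteq> pverts co_C7" "card X = 3" for X
      using card_active_nbhds_triple[OF that] by simp
  qed
  show "\<not> (\<exists>u v. false_twins co_C7 u v \<or> true_twins co_C7 u v)"
    by (simp add: co_C7_no_twins)
qed

end
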